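(* Let $X$ be a Banach space over $\mathbb{R}$ or $\mathbb{C}$, and let $X_1\subset X_2\subset\cdots\subset X$ be closed subspaces with $X=\overline{\bigcup_{m=1}^{\infty}X_m}$. Suppose that for every $m\in\mathbb{N}$ there is a continuous linear projection $P_m$ from $X_{m+1}$ onto $X_m$ with $\|P_m\|=1$, and that the norm of $X$ satisfies the Local Characterization Condition (LCC) with respect to $(X_m)$ and $(P_m)$. Then $$n(X)=\lim_{m\to\infty} n(X_m).$$
   Context: For a Banach space $Z$, $S_Z$ denotes its unit sphere, $Z^*$ its dual, and $\mathcal{L}(Z)$ the space of bounded linear operators on $Z$ with the operator norm. Numerical radius and index. For $T\in\mathcal{L}(Z)$, $\nu(T)=\sup\{|x^*(Tx)| : x\in S_Z,\ x^*\in S_{Z^*},\ x^*(x)=1\}$, and $n(Z)=\inf\{\nu(T): T\in\mathcal{L}(Z),\ \|T\|=1\}$. Norming functional. A norming functional for a nonzero $z\in Z$ is an $f\in Z^*$ with $\|f\|=1$ and $f(z)=\|z\|$. Local Characterization Condition (LCC). For every $m\in\mathbb{N}$, every $x\in X_{m+1}$ with $\|x\|=1$ and $P_mx\neq 0$, and every norming functional $x^*\in S_{X_{m+1}^*}$ for $x$, there exists a constant $b_m(x)\in\mathbb{R}$ such that $b_m(x)\,x^*|_{X_m}$ is a norming functional for $P_mx$ in $X_m^*$. *)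

theory Defs
  imports "HOL-Analysis.Analysis"
begin

text \<open>The scalar field is a type that is isometrically isomorphic, as a real normed field, to
  the reals or to the complex numbers.\<close>

class real_or_complex = real_normed_field +
  assumes real_or_complex:
    "\<exists>\<phi> :: 'a \<Rightarrow> complex.
       (\<forall>x y. \<phi> (x + y) = \<phi> x + \<phi> y) \<and> (\<forall>x y. \<phi> (x * y) = \<phi> x * \<phi> y) \<and>
       (\<forall>r x. \<phi> (r *\<^sub>R x) = r *\<^sub>R \<phi> x) \<and> (\<forall>x. norm (\<phi> x) = norm x) \<and>
       (range \<phi> = \<real> \<or> range \<phi> = UNIV)"

instance real :: real_or_complex
proof
  show "\<exists>\<phi> :: real \<Rightarrow> complex.
       (\<forall>x y. \<phi> (x + y) = \<phi> x + \<phi> y) \<and> (\<forall>x y. \<phi> (x * y) = \<phi> x * \<phi> y) \<and>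
       (\<forall>r x. \<phi> (r *\<^sub>R x) = r *\<^sub>R \<phi> x) \<and> (\<forall>x. norm (\<phi> x) = norm x) \<and>
       (range \<phi> = \<real> \<or> range \<phi> = UNIV)"
    by (rule exI[of _ complex_of_real]) (simp add: Reals_def scaleR_conv_of_real)
qed

instance complex :: real_or_complex
proof
  show "\<exists>\<phi> :: complex \<Rightarrow> complex.
       (\<forall>x y. \<phi> (x + y) = \<phi> x + \<phi> y) \<and> (\<forall>x y. \<phi> (x * y) = \<phi> x * \<phi> y) \<and>
       (\<forall>r x. \<phi> (r *\<^sub>R x) = r *\<^sub>R \<phi> x) \<and> (\<forall>x. norm (\<phi> x) = norm x) \<and>
       (range \<phi> = \<real> \<or> range \<phi> = UNIV)"
    by (rule exI[of _ "\<lambda>z. z"]) simp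
qed

text \<open>Banach spaces over \<^typ>\<open>'k\<close>: completeness and the norm come from the class
  \<^class>\<open>banach\<close>, whose real scalar multiplication has to be the restriction of the
  given one.\<close>

locale banach_space = vector_space smul
  for smul :: "'k::real_or_complex \<Rightarrow> 'a::banach \<Rightarrow> 'a" +
  assumes norm_smul: "norm (smul c x) = norm c * norm x"
    and smul_of_real: "smul (of_real r) x = r *\<^sub>R x"

lemma banach_space_scaleR: "banach_space (scaleR :: real \<Rightarrow> 'a::banach \<Rightarrow> 'a)"
  by unfold_locales (simp_all add: algebra_simps)

lemma banach_space_complex: "banach_space ((*) :: complex \<Rightarrow> complex \<Rightarrow> complex)"
  by unfold_locales (simp_all add: algebra_simps norm_mult scaleR_conv_of_real)

text \<open>Subspaces are sets \<^term>\<open>Z\<close>. Maps on a subspace are total functions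
  of which only the values on \<^term>\<open>Z\<close> are ever used.\<close>

definition bounded_linear_on ::
  "('k \<Rightarrow> 'a \<Rightarrow> 'a) \<Rightarrow> ('k \<Rightarrow> 'b \<Rightarrow> 'b) \<Rightarrow> 'a set \<Rightarrow> ('a::real_normed_vector \<Rightarrow> 'b::real_normed_vector) \<Rightarrow> bool"
  where "bounded_linear_on s1 s2 Z f \<longleftrightarrow>
    (\<forall>x\<in>Z. \<forall>y\<in>Z. f (x + y) = f x + f y) \<and>
    (\<forall>c. \<forall>x\<in>Z. f (s1 c x) = s2 c (f x)) \<and>
    (\<exists>K. \<forall>x\<in>Z. norm (f x) \<le> norm x * K)"

text \<open>As for \<^const>\<open>onorm\<close>, the quotient at \<open>x = 0\<close> is \<open>0\<close>.\<close>

definition onorm_on :: "'a set \<Rightarrow> ('a::real_normed_vector \<Rightarrow> 'b::real_normed_vector) \<Rightarrow> real"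
  where "onorm_on Z f = (SUP x\<in>Z. norm (f x) / norm x)"

definition operators_on :: "('k \<Rightarrow> 'a \<Rightarrow> 'a) \<Rightarrow> 'a set \<Rightarrow> ('a::real_normed_vector \<Rightarrow> 'a) set"
  where "operators_on smul Z = {T. bounded_linear_on smul smul Z T \<and> T ` Z \<subseteq> Z}"

definition dual_on :: "('k \<Rightarrow> 'a \<Rightarrow> 'a) \<Rightarrow> 'a set \<Rightarrow> ('a::real_normed_vector \<Rightarrow> 'k::real_normed_field) set"
  where "dual_on smul Z = {f. bounded_linear_on smul (*) Z f}"

text \<open>The real-valued \<^const>\<open>Sup\<close> and \<^const>\<open>Inf\<close> below are meaningful only for
  \<open>Z \<noteq> {0}\<close>, where the sets involved are nonempty and bounded.\<close>

definition numerical_radius ::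
  "('k::real_normed_field \<Rightarrow> 'a \<Rightarrow> 'a) \<Rightarrow> 'a set \<Rightarrow> ('a::real_normed_vector \<Rightarrow> 'a) \<Rightarrow> real"
  where "numerical_radius smul Z T =
    Sup {norm (f (T x)) | x f. x \<in> Z \<and> norm x = 1 \<and> f \<in> dual_on smul Z \<and> onorm_on Z f = 1 \<and> f x = 1}"

definition numerical_index ::
  "('k::real_normed_field \<Rightarrow> 'a \<Rightarrow> 'a) \<Rightarrow> 'a::real_normed_vector set \<Rightarrow> real"
  where "numerical_index smul Z =
    Inf {numerical_radius smul Z T | T. T \<in> operators_on smul Z \<and> onorm_on Z T = 1}"

definition norming_functional ::
  "('k::real_normed_field \<Rightarrow> 'a \<Rightarrow> 'a) \<Rightarrow> 'a set \<Rightarrow> ('a::real_normed_vector \<Rightarrow> 'k) \<Rightarrow> 'a \<Rightarrow> bool"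
  where "norming_functional smul Z f z \<longleftrightarrow>
    f \<in> dual_on smul Z \<and> onorm_on Z f = 1 \<and> f z = of_real (norm z)"

definition projection_onto ::
  "('k \<Rightarrow> 'a \<Rightarrow> 'a) \<Rightarrow> 'a set \<Rightarrow> 'a set \<Rightarrow> ('a::real_normed_vector \<Rightarrow> 'a) \<Rightarrow> bool"
  where "projection_onto smul Z Y P \<longleftrightarrow>
    P \<in> operators_on smul Z \<and> P ` Z = Y \<and> (\<forall>x\<in>Z. P (P x) = P x)"

definition local_characterization_condition ::
  "('k::real_normed_field \<Rightarrow> 'a \<Rightarrow> 'a) \<Rightarrow> (nat \<Rightarrow> 'a set) \<Rightarrow> (nat \<Rightarrow> 'a::real_normed_vector \<Rightarrow> 'a) \<Rightarrow> bool"
  where "local_characterization_condition smul X P \<longleftrightarrow>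
    (\<forall>m\<ge>1. \<forall>x\<in>X (m + 1). norm x = 1 \<and> P m x \<noteq> 0 \<longrightarrow>
      (\<forall>f. norming_functional smul (X (m + 1)) f x \<longrightarrow>
        (\<exists>b::real. norming_functional smul (X m) (\<lambda>z. of_real b * f z) (P m x))))"

end

theory Submission
  imports Defs
begin

text \<open>
  Composing the projections \<open>P\<^sub>k\<close> and extending by continuity gives norm-one projections \<open>Q\<^sub>m\<close> of \<open>X\<close>
  onto \<open>X\<^sub>m\<close>, which converge pointwise to the identity.

  For an operator \<open>T\<close> on \<open>X\<^sub>m\<close>, the operator \<open>S = T Q\<^sub>m\<close> has the same norm, and LCC shows by induction
  on \<open>k \<ge> m\<close> that the numerical radius of its restriction to \<open>X\<^sub>k\<close> is at most \<open>\<nu>(T)\<close>: a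
  supporting pair \<open>(x, f)\<close> of \<open>X\<^sub>k\<^sub>+\<^sub>1\<close> turns into one of \<open>X\<^sub>k\<close> at the normalised point \<open>P\<^sub>k x\<close>. A
  Lumer-type estimate of \<open>\<parallel>I + a S\<parallel>\<close> in terms of the numerical radius carries this bound over to the
  whole of \<open>X\<close>, so \<open>n(X) \<le> n(X\<^sub>m)\<close>.

  Conversely, for an operator \<open>S\<close> on \<open>X\<close> the compressions \<open>Q\<^sub>m S\<close> to \<open>X\<^sub>m\<close> satisfy
  \<open>\<nu>(Q\<^sub>m S) \<le> \<nu>(S)\<close>, because \<open>f Q\<^sub>m\<close> extends a functional \<open>f\<close> on \<open>X\<^sub>m\<close> without increasing its norm,
  while their norms tend to \<open>\<parallel>S\<parallel>\<close>. Hence \<open>limsup n(X\<^sub>m) \<le> n(X)\<close>.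
\<close>

section \<open>Existence of norming functionals\<close>

text \<open>Homogeneity is asked only as an inequality for positive factors, which is the form that
  an infimum of functionals inherits directly; applying it to \<open>t\<close> and to
  \<open>inverse t\<close> gives equality.\<close>

definition sublinear :: "('a::real_vector \<Rightarrow> real) \<Rightarrow> bool"
  where "sublinear p \<longleftrightarrow>
    (\<forall>x y. p (x + y) \<le> p x + p y) \<and> (\<forall>t>0. \<forall>x. p (t *\<^sub>R x) \<le> t * p x)"

lemma sublinear_norm: "sublinear (norm :: 'a::real_normed_vector \<Rightarrow> real)"
  by (auto simp: sublinear_def norm_triangle_ineq)

lemma sublinear_add: "sublinear p \<Longrightarrow> p (x + y) \<le> p x + p y"
  by (auto simp: sublinear_def)

lemma sublinear_0:
  assumes "sublinear p" shows "p 0 = 0"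
proof -
  have "p ((1/2) *\<^sub>R 0) \<le> (1/2) * p 0"
    using assms unfolding sublinear_def by (metis half_gt_zero zero_less_one)
  with sublinear_add[OF assms, of 0 0] show ?thesis by simp
qed

lemma sublinear_scaleR:
  assumes "sublinear p" "t \<ge> 0" shows "p (t *\<^sub>R x) = t * p x"
proof (cases "t = 0")
  case True
  then show ?thesis by (simp add: sublinear_0[OF assms(1)])
next
  case False
  then have t: "t > 0" using assms by simp
  have h: "p (s *\<^sub>R y) \<le> s * p y" if "s > 0" for s y
    using assms that by (simp add: sublinear_def)
  have "p (inverse t *\<^sub>R (t *\<^sub>R x)) \<le> inverse t * p (t *\<^sub>R x)"
    by (rule h) (simp add: t)
  then have "t * p x \<le> p (t *\<^sub>R x)"
    using t by (simp add: field_simps)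
  with h[OF t, of x] show ?thesis by simp
qed

lemma sublinear_minus:
  assumes "sublinear p" shows "- p (- x) \<le> p x"
  using sublinear_add[OF assms, of x "- x"] sublinear_0[OF assms] by simp

text \<open>The functional \<open>q z = (INF t\<ge>0. p (z + t y) - t p y)\<close>: a minimal \<open>p\<close> coincides with its
  shifts, which forces additivity.\<close>

lemma sublinear_shift:
  assumes p: "sublinear p"
  obtains q where "sublinear q" "\<And>x. q x \<le> p x" "\<And>x. q x \<le> p (x + y) - p y"
proof -
  define q where "q z = (INF t\<in>{0..}. p (z + t *\<^sub>R y) - t * p y)" for z
  have bdd: "bdd_below ((\<lambda>t. p (z + t *\<^sub>R y) - t * p y) ` {0..})" for z
  proof (rule bdd_belowI2[where m = "- p (- z)"])
    fix t :: real assume "t \<in> {0..}"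
    then show "- p (- z) \<le> p (z + t *\<^sub>R y) - t * p y"
      using sublinear_add[OF p, of "z + t *\<^sub>R y" "- z"] sublinear_scaleR[OF p, of t y] by simp
  qed
  have q_le: "q z \<le> p (z + t *\<^sub>R y) - t * p y" if "t \<ge> 0" for z t
    unfolding q_def using that by (intro cINF_lower[OF bdd]) auto
  have q_ge: "c \<le> q z" if "\<And>t. t \<ge> 0 \<Longrightarrow> c \<le> p (z + t *\<^sub>R y) - t * p y" for z c
    unfolding q_def using that by (intro cINF_greatest) auto
  have "sublinear q"
    unfolding sublinear_def
  proof (intro conjI allI impI)
    fix z w
    \<comment> \<open>The two infima are taken one after the other: parameter \<open>s\<close> for
      \<open>z\<close> and parameter \<open>t\<close> for \<open>w\<close> are matched by parameter
      \<open>s + t\<close> for \<open>z + w\<close>.\<close>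
    have "q (z + w) - q w \<le> q z"
    proof (rule q_ge)
      fix s :: real assume s: "s \<ge> 0"
      have "q (z + w) - (p (z + s *\<^sub>R y) - s * p y) \<le> q w"
      proof (rule q_ge)
        fix t :: real assume t: "t \<ge> 0"
        have "q (z + w) \<le> p (z + w + (s + t) *\<^sub>R y) - (s + t) * p y"
          using s t by (intro q_le) simp
        also have "z + w + (s + t) *\<^sub>R y = (z + s *\<^sub>R y) + (w + t *\<^sub>R y)"
          by (simp add: algebra_simps)
        finally show "q (z + w) - (p (z + s *\<^sub>R y) - s * p y) \<le> p (w + t *\<^sub>R y) - t * p y"
          using sublinear_add[OF p, of "z + s *\<^sub>R y" "w + t *\<^sub>R y"] by (simp add: algebra_simps)
      qed
      then show "q (z + w) - q w \<le> p (z + s *\<^sub>R y) - s * p y" by simp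
    qed
    then show "q (z + w) \<le> q z + q w" by simp
  next
    fix c :: real and z assume c: "c > 0"
    have "q (c *\<^sub>R z) / c \<le> q z"
    proof (rule q_ge)
      fix t :: real assume t: "t \<ge> 0"
      have "q (c *\<^sub>R z) \<le> p (c *\<^sub>R z + (c * t) *\<^sub>R y) - (c * t) * p y"
        using c t by (intro q_le) simp
      also have "c *\<^sub>R z + (c * t) *\<^sub>R y = c *\<^sub>R (z + t *\<^sub>R y)"
        by (simp add: algebra_simps)
      also have "p \<dots> = c * p (z + t *\<^sub>R y)"
        using c by (intro sublinear_scaleR[OF p]) simp
      finally show "q (c *\<^sub>R z) / c \<le> p (z + t *\<^sub>R y) - t * p y"
        using c by (simp add: field_simps)
    qed
    then show "q (c *\<^sub>R z) \<le> c * q z" using c by (simp add: field_simps)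
  qed
  \<comment> \<open>The two bounds are the members \<open>t = 0\<close> and \<open>t = 1\<close> of
    the infimum.\<close>
  then show thesis
    using that[of q] q_le[of 0] q_le[of 1] by simp
qed

text \<open>Zorn's lemma for the reversed pointwise order. The infimum of a nonempty chain is a
  lower bound, and it is finite because \<open>q \<le> p\<close> forces
  \<open>- p (- z) \<le> q z\<close>.\<close>

lemma minimal_sublinear_exists:
  assumes p: "sublinear p"
  obtains g where "sublinear g" "g \<le> p" "\<And>q. sublinear q \<Longrightarrow> q \<le> g \<Longrightarrow> q = g"
proof -
  define A where "A = {q. sublinear q \<and> q \<le> p}"
  have "\<exists>m\<in>A. \<forall>a\<in>A. m \<ge> a \<longrightarrow> a = m"
  proof (rule predicate_Zorn)
    show "partial_order_on A (relation_of (\<ge>) A)"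
      by (auto simp: partial_order_on_def preorder_on_def refl_on_def trans_def antisym_def
          relation_of_def)
  next
    fix C assume C: "C \<in> Chains (relation_of (\<ge>) A)"
    then have CA: "C \<subseteq> A" and tot: "\<And>a b. a \<in> C \<Longrightarrow> b \<in> C \<Longrightarrow> a \<le> b \<or> b \<le> a"
      unfolding Chains_def relation_of_def by auto
    show "\<exists>u\<in>A. \<forall>a\<in>C. a \<ge> u"
    proof (cases "C = {}")
      case True
      then show ?thesis using p by (auto simp: A_def)
    next
      case False
      then obtain q0 where q0: "q0 \<in> C" by blast
      define u where "u z = (INF q\<in>C. q z)" for z
      have sub: "sublinear q" "q \<le> p" if "q \<in> C" for q
        using CA that by (auto simp: A_def)
      have bdd: "bdd_below ((\<lambda>q. q z) ` C)" for z
      proof (rule bdd_belowI2[where m = "- p (- z)"])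
        fix q assume q: "q \<in> C"
        show "- p (- z) \<le> q z"
          using sublinear_minus[OF sub(1)[OF q], of z] le_funD[OF sub(2)[OF q], of "- z"] by simp
      qed
      have u_le: "u z \<le> q z" if "q \<in> C" for q z
        unfolding u_def using that by (intro cINF_lower[OF bdd])
      have u_ge: "c \<le> u z" if "\<And>q. q \<in> C \<Longrightarrow> c \<le> q z" for z c
        unfolding u_def using that False by (intro cINF_greatest)
      have "sublinear u"
        unfolding sublinear_def
      proof (intro conjI allI impI)
        fix z w
        have "u (z + w) - u w \<le> u z"
        proof (rule u_ge)
          fix q1 assume q1: "q1 \<in> C"
          have "u (z + w) - q1 z \<le> u w"
          proof (rule u_ge)
            fix q2 assume q2: "q2 \<in> C"
            \<comment> \<open>Subadditivity survives the infimum because in a chain the smaller of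
              two members serves for both summands.\<close>
            obtain q where q: "q \<in> C" "q \<le> q1" "q \<le> q2" using tot[OF q1 q2] q1 q2 by auto
            show "u (z + w) - q1 z \<le> q2 w"
              using u_le[OF q(1), of "z + w"] sublinear_add[OF sub(1)[OF q(1)], of z w]
                le_funD[OF q(2), of z] le_funD[OF q(3), of w] by linarith
          qed
          then show "u (z + w) - u w \<le> q1 z" by simp
        qed
        then show "u (z + w) \<le> u z + u w" by simp
      next
        fix c :: real and z assume c: "c > 0"
        have "u (c *\<^sub>R z) / c \<le> u z"
        proof (rule u_ge)
          fix q assume q: "q \<in> C"
          show "u (c *\<^sub>R z) / c \<le> q z"
            using u_le[OF q, of "c *\<^sub>R z"] sublinear_scaleR[OF sub(1)[OF q], of c z] c
            by (simp add: field_simps)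
        qed
        then show "u (c *\<^sub>R z) \<le> c * u z" using c by (simp add: field_simps)
      qed
      moreover have "u \<le> p"
        by (rule le_funI) (meson u_le[OF q0] le_funD[OF sub(2)[OF q0]] order_trans)
      ultimately have "u \<in> A" by (simp add: A_def)
      moreover have "\<forall>a\<in>C. a \<ge> u" using u_le by (auto intro: le_funI)
      ultimately show ?thesis by blast
    qed
  qed
  then obtain g where "g \<in> A" and "\<And>a. a \<in> A \<Longrightarrow> a \<le> g \<Longrightarrow> a = g" by blast
  then show thesis
    using that[of g] by (auto simp: A_def)
qed

text \<open>By minimality \<open>g\<close> equals its own shift in every direction \<open>y\<close>,
  so the bound on the shift becomes superadditivity.\<close>

lemma minimal_sublinear_linear:
  assumes g: "sublinear g" and min: "\<And>q. sublinear q \<Longrightarrow> q \<le> g \<Longrightarrow> q = g"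
  shows "linear g"
proof -
  have add: "g (x + y) = g x + g y" for x y
  proof -
    obtain q where q: "sublinear q" "\<And>z. q z \<le> g z" "\<And>z. q z \<le> g (z + y) - g y"
      using sublinear_shift[OF g] by metis
    have "q = g" using q by (intro min) (auto intro: le_funI)
    then show ?thesis using q(3)[of x] sublinear_add[OF g, of x y] by simp
  qed
  have minus: "g (- x) = - g x" for x
    using add[of x "- x"] sublinear_0[OF g] by simp
  have "g (t *\<^sub>R x) = t * g x" for t x
  proof (cases "t \<ge> 0")
    case True
    then show ?thesis by (rule sublinear_scaleR[OF g])
  next
    case False
    then show ?thesis
      using sublinear_scaleR[OF g, of "- t" x] minus[of "t *\<^sub>R x"] by simp
  qed
  then show ?thesis by (intro linearI add) simp
qed

text \<open>Minimising below the shift of the norm in direction \<open>x\<close>, rather than below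
  the norm itself, forces the value at \<open>x\<close>: the shift is at most
  \<open>- norm x\<close> at \<open>- x\<close>.\<close>

lemma real_norming_functional_exists:
  fixes x :: "'a::real_normed_vector"
  obtains g where "linear g" "\<And>z. g z \<le> norm z" "g x = norm x"
proof -
  obtain q where q: "sublinear q" "\<And>z. q z \<le> norm z" "\<And>z. q z \<le> norm (z + x) - norm x"
    using sublinear_shift[OF sublinear_norm] by metis
  obtain g where g: "sublinear g" "g \<le> q" "\<And>r. sublinear r \<Longrightarrow> r \<le> g \<Longrightarrow> r = g"
    using minimal_sublinear_exists[OF q(1)] by metis
  have lin: "linear g" using g by (intro minimal_sublinear_linear)
  have le: "g z \<le> norm z" for z
    using le_funD[OF g(2)] q(2) order_trans by blast
  have "g (- x) \<le> - norm x"
    using le_funD[OF g(2), of "- x"] q(3)[of "- x"] by simp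
  then have "g x = norm x"
    using le[of x] linear_neg[OF lin, of x] by simp
  with lin le show thesis by (rule that)
qed

text \<open>In the complex case the preimage \<open>i\<close> of the imaginary unit gives real
  coordinates in which the norm is Euclidean. This is the form in which the passage from real to
  complex functionals uses the scalar field.\<close>

lemma real_or_complex_cases:
  obtains (real) "\<forall>c::'k::real_or_complex. \<exists>r. c = of_real r"
  | (complex) i where "i * i = (-1::'k)" "\<And>c. \<exists>a b. c = of_real a + of_real b * i"
      "\<And>a b. (norm (of_real a + of_real b * i))\<^sup>2 = a\<^sup>2 + b\<^sup>2"
proof -
  from real_or_complex[where 'a = 'k] show thesis
  proof (elim exE conjE)
    fix \<phi> :: "'k \<Rightarrow> complex"
    assume A: "\<forall>x y. \<phi> (x + y) = \<phi> x + \<phi> y" "\<forall>x y. \<phi> (x * y) = \<phi> x * \<phi> y"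
      "\<forall>r x. \<phi> (r *\<^sub>R x) = r *\<^sub>R \<phi> x" "\<forall>x. norm (\<phi> x) = norm x"
      and ran: "range \<phi> = \<real> \<or> range \<phi> = UNIV"
    note add = A(1)[rule_format] and mult = A(2)[rule_format] and scale = A(3)[rule_format]
      and norm = A(4)[rule_format]
    have "norm (\<phi> 1) = 1" by (simp add: norm)
    moreover have "\<phi> 1 * \<phi> 1 = \<phi> 1" using mult[of 1 1, symmetric] by simp
    ultimately have one: "\<phi> 1 = 1" by (metis mult_cancel_right2 norm_zero zero_neq_one)
    have inj: "x = y" if "\<phi> x = \<phi> y" for x y
    proof -
      have "\<phi> x = \<phi> (x - y) + \<phi> y" using add[of "x - y" y] by simp
      then have "\<phi> y = \<phi> (x - y) + \<phi> y" unfolding that .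
      then have "\<phi> (x - y) = 0" by (rule add_cancel_right_left[THEN iffD1])
      then show ?thesis using norm[of "x - y"] by simp
    qed
    have of_real: "\<phi> (of_real r) = of_real r" for r
      using scale[of r 1] by (simp only: of_real_def one)
    from ran show thesis
    proof
      assume "range \<phi> = \<real>"
      have "\<exists>r. c = of_real r" for c :: 'k
      proof -
        have "\<phi> c \<in> \<real>" using \<open>range \<phi> = \<real>\<close> by blast
        then obtain r where "\<phi> c = of_real r" by (rule Reals_cases)
        then have "\<phi> c = \<phi> (of_real r)" unfolding of_real .
        then show ?thesis by (intro exI inj)
      qed
      then show thesis by (intro real allI)
    next
      assume "range \<phi> = UNIV"
      then obtain i where i: "\<phi> i = \<i>" by (metis UNIV_I imageE)
      have c: "\<phi> (of_real a + of_real b * i) = Complex a b" for a b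
        by (simp add: add mult of_real i complex_eq_iff)
      show thesis
      proof (rule complex)
        have "\<phi> (-1) = -1" using of_real[of "-1"] by simp
        then show "i * i = -1" by (intro inj) (simp add: mult i)
        show "\<exists>a b. x = of_real a + of_real b * i" for x
          by (rule exI[of _ "Re (\<phi> x)"], rule exI[of _ "Im (\<phi> x)"], rule inj) (simp add: c)
        show "(norm (of_real a + of_real b * i))\<^sup>2 = a\<^sup>2 + b\<^sup>2" for a b
          by (metis norm c cmod_power2 complex.sel)
      qed
    qed
  qed
qed

lemma unit_scalar_exists:
  fixes v :: "'k::real_normed_field"
  obtains c where "norm c = 1" "c * v = of_real (norm v)"
proof (cases "v = 0")
  case True
  then show thesis using that[of 1] by simp
next
  case False
  then show thesis using that[of "of_real (norm v) / v"] by (simp add: norm_divide)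
qed

section \<open>Norming functionals over the given scalar field\<close>

context banach_space
begin

lemma norming_functional_exists:
  obtains f where "f \<in> dual_on smul UNIV" "\<And>y. norm (f y) \<le> norm y" "f x = of_real (norm x)"
proof -
  obtain g where g: "linear g" "\<And>z. g z \<le> norm z" "g x = norm x"
    using real_norming_functional_exists by blast
  note lin = linear_add[OF g(1)] linear_diff[OF g(1)] linear_neg[OF g(1)] linear_cmul[OF g(1)]
  show thesis
  proof (cases rule: real_or_complex_cases[where 'k = 'k])
    case real
    define f :: "'a \<Rightarrow> 'k" where "f y = of_real (g y)" for y
    have b: "norm (f y) \<le> norm y" for y
      using g(2)[of y] g(2)[of "- y"] by (simp add: f_def lin)
    have "f (smul c y) = c * f y" for c y
    proof -
      obtain r where "c = of_real r" using real by blast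
      then show ?thesis by (simp add: f_def smul_of_real lin)
    qed
    moreover have "f (y + z) = f y + f z" for y z by (simp add: f_def lin)
    ultimately have "f \<in> dual_on smul UNIV"
      using b by (auto simp: dual_on_def bounded_linear_on_def intro!: exI[of _ 1])
    then show thesis by (rule that[OF _ b]) (simp add: f_def g(3))
  next
    case (complex i)
    \<comment> \<open>The usual complexification: \<open>g\<close> becomes the real part, and
      linearity over \<open>i\<close> then dictates the imaginary part.\<close>
    define f :: "'a \<Rightarrow> 'k" where "f y = of_real (g y) - of_real (g (smul i y)) * i" for y
    have f_i: "f (smul i y) = i * f y" for y
    proof -
      have "f (smul i y) = of_real (g (smul i y)) - of_real (g (smul (i * i) y)) * i"
        by (simp add: f_def)
      also have "\<dots> = of_real (g (smul i y)) + of_real (g y) * i"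
        by (simp add: complex(1) lin)
      also have "\<dots> = of_real (g y) * i - (i * i) * of_real (g (smul i y))"
        by (simp add: complex(1))
      also have "\<dots> = i * f y"
        by (simp only: f_def right_diff_distrib mult_ac)
      finally show ?thesis .
    qed
    have f_add: "f (y + z) = f y + f z" for y z
      by (simp add: f_def lin scale_right_distrib algebra_simps)
    have f_real: "f (smul (of_real r) y) = of_real r * f y" for r y
    proof -
      have "smul i (r *\<^sub>R y) = r *\<^sub>R smul i y"
        by (metis scale_left_commute smul_of_real)
      then show ?thesis by (simp add: f_def smul_of_real lin algebra_simps)
    qed
    have f_smul: "f (smul c y) = c * f y" for c y
    proof -
      obtain a b where c: "c = of_real a + of_real b * i" using complex(2) by blast
      have "smul c y = smul (of_real a) y + smul (of_real b) (smul i y)"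
        by (simp add: c scale_left_distrib)
      then have "f (smul c y) = of_real a * f y + of_real b * (i * f y)"
        by (simp only: f_add f_real f_i)
      then show ?thesis by (simp add: c algebra_simps)
    qed
    have nrm: "(norm (of_real r - of_real s * i))\<^sup>2 = r\<^sup>2 + s\<^sup>2" for r s
      using complex(3)[of r "- s"] by simp
    have b: "norm (f y) \<le> norm y" for y
    proof -
      \<comment> \<open>Rotating \<open>y\<close> by \<open>c\<close> makes the value of
        \<open>f\<close> real and nonnegative, so that it equals the value of \<open>g\<close> there
        and inherits the bound on \<open>g\<close>.\<close>
      obtain c where c: "norm c = 1" "c * f y = of_real (norm (f y))"
        using unit_scalar_exists by blast
      have "of_real (norm (f y)) = f (smul c y)" by (simp add: f_smul c)
      then have "of_real (g (smul c y) - norm (f y)) - of_real (g (smul i (smul c y))) * i = 0"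
        by (simp add: f_def)
      then have "(g (smul c y) - norm (f y))\<^sup>2 + (g (smul i (smul c y)))\<^sup>2 = 0"
        using nrm by (metis norm_zero zero_eq_power2)
      then have "norm (f y) = g (smul c y)" by (simp add: sum_power2_eq_zero_iff)
      also have "\<dots> \<le> norm y" using g(2)[of "smul c y"] by (simp add: norm_smul c)
      finally show ?thesis .
    qed
    \<comment> \<open>The real coordinate \<open>g x = norm x\<close> already exhausts the bound, so
      the imaginary one vanishes.\<close>
    have "(norm (f x))\<^sup>2 \<le> (norm x)\<^sup>2" by (intro power_mono b) simp
    then have "g (smul i x) = 0" by (simp add: f_def nrm g(3))
    then have "f x = of_real (norm x)" by (simp add: f_def g(3))
    moreover have "f \<in> dual_on smul UNIV"
      using b by (auto simp: dual_on_def bounded_linear_on_def f_add f_smul intro!: exI[of _ 1])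
    ultimately show thesis using that[of f] b by blast
  qed
qed

end

section \<open>Operator norms on subspaces\<close>

lemma onorm_on_le:
  assumes "Z \<noteq> {}" "0 \<le> c" "\<And>x. x \<in> Z \<Longrightarrow> norm (f x) \<le> c * norm x"
  shows "onorm_on Z f \<le> c"
  unfolding onorm_on_def
proof (rule cSUP_least)
  fix x assume "x \<in> Z"
  then show "norm (f x) / norm x \<le> c"
    using assms by (cases "norm x = 0") (auto simp: field_simps)
qed fact

lemma norm_le_onorm_on:
  assumes f: "bounded_linear_on s1 s2 Z f" and x: "x \<in> Z"
  shows "norm (f x) \<le> onorm_on Z f * norm x"
proof -
  obtain K where K: "\<And>y. y \<in> Z \<Longrightarrow> norm (f y) \<le> norm y * K"
    using f unfolding bounded_linear_on_def by blast
  have "bdd_above ((\<lambda>y. norm (f y) / norm y) ` Z)"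
  proof (rule bdd_aboveI2)
    fix y assume "y \<in> Z"
    \<comment> \<open>\<open>K\<close> carries no sign condition and can be negative when
      \<open>Z\<close> is trivial; its absolute value also bounds the quotient \<open>0\<close> at
      the origin.\<close>
    then have "norm (f y) \<le> norm y * \<bar>K\<bar>"
      using K[of y] by (meson abs_ge_self mult_left_mono norm_ge_zero order_trans)
    then show "norm (f y) / norm y \<le> \<bar>K\<bar>"
      by (cases "norm y = 0") (auto simp: field_simps)
  qed
  then have "norm (f x) / norm x \<le> onorm_on Z f"
    unfolding onorm_on_def using x by (intro cSUP_upper)
  then show ?thesis
    using K[OF x] by (cases "norm x = 0") (auto simp: field_simps)
qed

lemma onorm_on_nonneg:
  assumes f: "bounded_linear_on s1 s2 Z f" and x: "x \<in> Z" "x \<noteq> 0"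
  shows "0 \<le> onorm_on Z f"
proof -
  have "0 \<le> onorm_on Z f * norm x" using norm_le_onorm_on[OF f x(1)] norm_ge_zero order_trans by blast
  then show ?thesis using x(2) by (simp add: zero_le_mult_iff)
qed

text \<open>A unit vector with an image of norm 1 bounds the operator norm below by 1, so only the
  upper bound is left to decide.\<close>

lemma onorm_on_eq_1_iff:
  assumes f: "bounded_linear_on s1 s2 Z f" and x: "x \<in> Z" "norm x = 1" "norm (f x) = 1"
  shows "onorm_on Z f = 1 \<longleftrightarrow> (\<forall>y\<in>Z. norm (f y) \<le> norm y)"
proof
  assume "onorm_on Z f = 1"
  then show "\<forall>y\<in>Z. norm (f y) \<le> norm y"
    using norm_le_onorm_on[OF f] by simp
next
  assume "\<forall>y\<in>Z. norm (f y) \<le> norm y"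
  then have "onorm_on Z f \<le> 1" using x(1) by (intro onorm_on_le) auto
  moreover have "1 \<le> onorm_on Z f" using norm_le_onorm_on[OF f x(1)] x by simp
  ultimately show "onorm_on Z f = 1" by simp
qed

lemma bounded_linear_on_subset:
  "bounded_linear_on s1 s2 Z f \<Longrightarrow> Y \<subseteq> Z \<Longrightarrow> bounded_linear_on s1 s2 Y f"
  unfolding bounded_linear_on_def by blast

lemma bounded_linear_on_compose:
  assumes "bounded_linear_on s1 s2 Z f" "bounded_linear_on s2 s3 Y g" "f ` Z \<subseteq> Y"
  shows "bounded_linear_on s1 s3 Z (\<lambda>x. g (f x))"
proof -
  obtain K L where K: "\<And>x. x \<in> Z \<Longrightarrow> norm (f x) \<le> norm x * K"
    and L: "\<And>x. x \<in> Y \<Longrightarrow> norm (g x) \<le> norm x * L"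
    using assms unfolding bounded_linear_on_def by blast
  have "norm (g (f x)) \<le> norm x * (K * \<bar>L\<bar>)" if "x \<in> Z" for x
  proof -
    have "norm (g (f x)) \<le> norm (f x) * L" using L that assms(3) by auto
    also have "\<dots> \<le> norm (f x) * \<bar>L\<bar>" by (intro mult_left_mono) auto
    also have "\<dots> \<le> norm x * K * \<bar>L\<bar>" by (intro mult_right_mono K that) auto
    finally show ?thesis by (simp add: mult.assoc)
  qed
  moreover have "g (f (x + y)) = g (f x) + g (f y)" if "x \<in> Z" "y \<in> Z" for x y
    using assms that by (auto simp: bounded_linear_on_def image_subset_iff)
  moreover have "g (f (s1 c x)) = s3 c (g (f x))" if "x \<in> Z" for c x
    using assms that by (auto simp: bounded_linear_on_def image_subset_iff)
  ultimately show ?thesis unfolding bounded_linear_on_def by blast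
qed

section \<open>Numerical radius and numerical index\<close>

text \<open>The index set of the numerical radius. Dual norm 1 is written as a pointwise bound,
  which is equivalent since \<open>f x = 1\<close> at a unit vector.\<close>

definition supporting_pairs ::
  "('k::real_normed_field \<Rightarrow> 'a \<Rightarrow> 'a) \<Rightarrow> 'a set \<Rightarrow> ('a::real_normed_vector \<times> ('a \<Rightarrow> 'k)) set"
  where "supporting_pairs smul Z =
    {(x, f). x \<in> Z \<and> norm x = 1 \<and> f \<in> dual_on smul Z \<and> (\<forall>y\<in>Z. norm (f y) \<le> norm y) \<and> f x = 1}"

lemma supporting_pairs_iff_onorm_on:
  "(x, f) \<in> supporting_pairs smul Z \<longleftrightarrow>
    x \<in> Z \<and> norm x = 1 \<and> f \<in> dual_on smul Z \<and> onorm_on Z f = 1 \<and> f x = 1"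
  using onorm_on_eq_1_iff[of smul "(*)" Z f x]
  by (auto simp: supporting_pairs_def dual_on_def)

lemma numerical_radius_eq_SUP:
  "numerical_radius smul Z T = (SUP (x, f)\<in>supporting_pairs smul Z. norm (f (T x)))"
  unfolding numerical_radius_def
  by (rule arg_cong[where f = Sup]) (force simp: supporting_pairs_iff_onorm_on)

lemma bdd_above_numerical_range:
  assumes "T \<in> operators_on smul Z"
  shows "bdd_above ((\<lambda>(x, f). norm (f (T x))) ` supporting_pairs smul Z)"
proof (rule bdd_aboveI2[where M = "onorm_on Z T"])
  fix p assume "p \<in> supporting_pairs smul Z"
  then show "(case p of (x, f) \<Rightarrow> norm (f (T x))) \<le> onorm_on Z T"
    using assms norm_le_onorm_on[of smul smul Z T "fst p"]
    by (fastforce simp: supporting_pairs_def operators_on_def)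
qed

lemma numerical_radius_upper:
  assumes "T \<in> operators_on smul Z" "(x, f) \<in> supporting_pairs smul Z"
  shows "norm (f (T x)) \<le> numerical_radius smul Z T"
  unfolding numerical_radius_eq_SUP
  using cSUP_upper[OF assms(2) bdd_above_numerical_range[OF assms(1)]] by simp

context banach_space
begin

lemma subspace_scaleR: "subspace Z \<Longrightarrow> x \<in> Z \<Longrightarrow> r *\<^sub>R x \<in> Z"
  by (metis smul_of_real subspace_scale)

lemma bounded_linear_on_scaleR:
  assumes "bounded_linear_on smul smul Z T" "x \<in> Z"
  shows "T (r *\<^sub>R x) = r *\<^sub>R T x"
  using assms unfolding bounded_linear_on_def smul_of_real[symmetric] by blast

lemma dual_on_scaleR:
  assumes "f \<in> dual_on smul Z" "x \<in> Z"
  shows "f (r *\<^sub>R x) = of_real r * f x"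
  using assms unfolding dual_on_def bounded_linear_on_def smul_of_real[symmetric] by blast

lemma bounded_linear_smul: "bounded_linear (smul a)"
  by (intro bounded_linear_intro[where K = "norm a"])
    (auto simp: norm_smul scale_right_distrib scale_left_commute simp flip: smul_of_real)

lemma supporting_pair_exists:
  assumes Z: "subspace Z" and x: "x \<in> Z" "x \<noteq> 0"
  obtains f where "(x /\<^sub>R norm x, f) \<in> supporting_pairs smul Z"
    "f \<in> dual_on smul Z" "f x = of_real (norm x)" "\<And>y. norm (f y) \<le> norm y"
proof -
  obtain f where f: "f \<in> dual_on smul UNIV" "\<And>y. norm (f y) \<le> norm y" "f x = of_real (norm x)"
    using norming_functional_exists by blast
  have d: "f \<in> dual_on smul Z"
    using f(1) bounded_linear_on_subset unfolding dual_on_def by blast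
  have "f (x /\<^sub>R norm x) = 1"
    using x dual_on_scaleR[OF d x(1)] by (simp add: f(3) flip: of_real_mult)
  then have "(x /\<^sub>R norm x, f) \<in> supporting_pairs smul Z"
    using x d f(2) subspace_scaleR[OF Z x(1)] by (simp add: supporting_pairs_def)
  then show thesis using that d f by blast
qed

lemma supporting_pairs_nonempty:
  assumes "subspace Z" "Z \<noteq> {0}"
  shows "supporting_pairs smul Z \<noteq> {}"
proof -
  obtain x where "x \<in> Z" "x \<noteq> 0" using assms subspace_0 by blast
  then show ?thesis using supporting_pair_exists[OF assms(1)] by blast
qed

lemma numerical_radius_least:
  assumes "subspace Z" "Z \<noteq> {0}"
    and "\<And>x f. (x, f) \<in> supporting_pairs smul Z \<Longrightarrow> norm (f (T x)) \<le> c"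
  shows "numerical_radius smul Z T \<le> c"
  unfolding numerical_radius_eq_SUP
  using supporting_pairs_nonempty[OF assms(1,2)] assms(3) by (intro cSUP_least) auto

lemma numerical_radius_nonneg:
  assumes "subspace Z" "Z \<noteq> {0}" "T \<in> operators_on smul Z"
  shows "0 \<le> numerical_radius smul Z T"
proof -
  obtain x f where "(x, f) \<in> supporting_pairs smul Z"
    using supporting_pairs_nonempty[OF assms(1,2)] by auto
  from numerical_radius_upper[OF assms(3) this] show ?thesis
    using norm_ge_zero order_trans by blast
qed

lemma onorm_on_trivial: "T \<in> operators_on smul {0} \<Longrightarrow> onorm_on {0} T = 0"
  by (simp add: onorm_on_def)

lemma numerical_index_le:
  assumes Z: "subspace Z" and T: "T \<in> operators_on smul Z" "onorm_on Z T = 1"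
  shows "numerical_index smul Z \<le> numerical_radius smul Z T"
  unfolding numerical_index_def
proof (rule cInf_lower)
  show "bdd_below {numerical_radius smul Z T |T. T \<in> operators_on smul Z \<and> onorm_on Z T = 1}"
  proof (rule bdd_belowI)
    fix r assume "r \<in> {numerical_radius smul Z T |T. T \<in> operators_on smul Z \<and> onorm_on Z T = 1}"
    then obtain S where "r = numerical_radius smul Z S" "S \<in> operators_on smul Z" "onorm_on Z S = 1"
      by blast
    \<comment> \<open>On the zero space every operator has norm 0, so an operator of norm 1 forces
      \<open>Z\<close> to be nontrivial.\<close>
    then show "0 \<le> r" using numerical_radius_nonneg[OF Z] onorm_on_trivial by fastforce
  qed
qed (use T in blast)

lemma id_operator:
  assumes "subspace Z" "Z \<noteq> {0}"
  shows "(\<lambda>x. x) \<in> operators_on smul Z" "onorm_on Z (\<lambda>x. x) = 1"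
proof -
  show id: "(\<lambda>x. x) \<in> operators_on smul Z"
    by (auto simp: operators_on_def bounded_linear_on_def intro: exI[of _ 1])
  obtain x f where "(x, f) \<in> supporting_pairs smul Z"
    using supporting_pairs_nonempty[OF assms] by auto
  then show "onorm_on Z (\<lambda>x. x) = 1"
    using id onorm_on_eq_1_iff[of smul smul Z "\<lambda>x. x" x]
    by (auto simp: supporting_pairs_def operators_on_def)
qed

lemma numerical_index_greatest:
  assumes Z: "subspace Z" "Z \<noteq> {0}"
    and "\<And>T. T \<in> operators_on smul Z \<Longrightarrow> onorm_on Z T = 1 \<Longrightarrow> c \<le> numerical_radius smul Z T"
  shows "c \<le> numerical_index smul Z"
  unfolding numerical_index_def
  \<comment> \<open>The identity makes the set nonempty, as the real infimum requires.\<close>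
  using assms(3) id_operator[OF Z] by (intro cInf_greatest) blast+

lemma numerical_index_le_1:
  assumes "subspace Z" "Z \<noteq> {0}"
  shows "numerical_index smul Z \<le> 1"
proof -
  have "numerical_radius smul Z (\<lambda>x. x) \<le> 1"
    using assms by (intro numerical_radius_least) (auto simp: supporting_pairs_def)
  then show ?thesis
    using numerical_index_le[OF assms(1) id_operator[OF assms]] by simp
qed

text \<open>Both sides are positively homogeneous in \<open>T\<close>, so the estimate reduces to
  norm 1, where it is the definition of the index; for norm 0 it is nonnegativity of the
  radius.\<close>

lemma numerical_index_times_onorm_on_le:
  assumes Z: "subspace Z" "Z \<noteq> {0}" and T: "T \<in> operators_on smul Z"
  shows "numerical_index smul Z * onorm_on Z T \<le> numerical_radius smul Z T"
proof -
  define r where "r = onorm_on Z T"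
  have bT: "bounded_linear_on smul smul Z T" and TZ: "T ` Z \<subseteq> Z"
    using T by (auto simp: operators_on_def)
  obtain x where x: "x \<in> Z" "norm x = 1"
    using supporting_pairs_nonempty[OF Z] by (auto simp: supporting_pairs_def)
  have r: "norm (T y) \<le> r * norm y" if "y \<in> Z" for y
    unfolding r_def by (rule norm_le_onorm_on[OF bT that])
  have "0 \<le> r" using order_trans[OF norm_ge_zero r[OF x(1)]] x(2) by simp
  show ?thesis
  proof (cases "r = 0")
    case True
    then show ?thesis using numerical_radius_nonneg[OF Z T] by (simp add: r_def)
  next
    case False
    with \<open>0 \<le> r\<close> have "r > 0" by simp
    define S where "S y = T y /\<^sub>R r" for y
    have nS: "norm (S y) = norm (T y) / r" for y
      using \<open>r > 0\<close> by (simp add: S_def field_simps)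
    have bS: "bounded_linear_on smul smul Z S"
      unfolding bounded_linear_on_def
    proof (intro conjI ballI allI exI[of _ 1])
      fix y z c assume y: "y \<in> Z"
      show "S (smul c y) = smul c (S y)"
        using bT y unfolding S_def bounded_linear_on_def
        by (metis scale_left_commute smul_of_real)
      show "norm (S y) \<le> norm y * 1"
        using r[OF y] \<open>r > 0\<close> by (simp add: nS field_simps)
      assume "z \<in> Z"
      then show "S (y + z) = S y + S z"
        using bT y by (simp add: S_def bounded_linear_on_def scaleR_add_right)
    qed
    then have S: "S \<in> operators_on smul Z"
      using TZ subspace_scaleR[OF Z(1)] by (auto simp: operators_on_def S_def)
    have "onorm_on Z S = 1"
    proof (rule antisym)
      show "onorm_on Z S \<le> 1"
        using r \<open>r > 0\<close> x(1) by (intro onorm_on_le) (auto simp: nS field_simps)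
      have "r \<le> onorm_on Z S * r"
        unfolding r_def
      proof (rule onorm_on_le)
        have "0 \<le> onorm_on Z S"
          using x by (intro onorm_on_nonneg[OF bS x(1)]) auto
        then show "0 \<le> onorm_on Z S * onorm_on Z T"
          using \<open>r > 0\<close> by (simp add: r_def)
        fix y assume "y \<in> Z"
        then show "norm (T y) \<le> onorm_on Z S * onorm_on Z T * norm y"
          using norm_le_onorm_on[OF bS, of y] \<open>r > 0\<close> by (simp add: nS field_simps flip: r_def)
      qed (use x in blast)
      then show "1 \<le> onorm_on Z S" using \<open>r > 0\<close> by simp
    qed
    then have "numerical_index smul Z \<le> numerical_radius smul Z S"
      by (rule numerical_index_le[OF Z(1) S])
    also have "\<dots> \<le> numerical_radius smul Z T / r"
    proof (rule numerical_radius_least[OF Z])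
      fix y f assume p: "(y, f) \<in> supporting_pairs smul Z"
      then have "f (S y) = of_real (inverse r) * f (T y)"
        unfolding S_def supporting_pairs_def using TZ by (intro dual_on_scaleR[of _ Z]) auto
      then have "norm (f (S y)) = norm (f (T y)) / r"
        using \<open>r > 0\<close> by (simp add: norm_mult norm_inverse divide_inverse mult.commute)
      then show "norm (f (S y)) \<le> numerical_radius smul Z T / r"
        using numerical_radius_upper[OF T p] \<open>r > 0\<close> by (simp add: divide_right_mono)
    qed
    finally show ?thesis using \<open>r > 0\<close> by (simp add: r_def field_simps)
  qed
qed

text \<open>A norming functional of \<open>z\<close> gives \<open>\<parallel>z - a T z\<parallel> \<ge> (1 - \<bar>a\<bar> c) \<parallel>z\<parallel>\<close>; the estimate is this one at
  \<open>z = x + a T x\<close>, where \<open>z - a T z = x - a\<^sup>2 T (T x)\<close>. Unlike the hypothesis on supporting pairs, it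
  is a closed condition on \<open>x\<close> and so survives the passage to the closure of a union.\<close>

lemma norm_add_smul_le:
  assumes Z: "subspace Z" and T: "T \<in> operators_on smul Z" and "0 \<le> K"
    and K: "\<And>y. y \<in> Z \<Longrightarrow> norm (T y) \<le> K * norm y"
    and c: "\<And>y f. (y, f) \<in> supporting_pairs smul Z \<Longrightarrow> norm (f (T y)) \<le> c"
    and x: "x \<in> Z"
  shows "(1 - norm a * c) * norm (x + smul a (T x)) \<le> (1 + (norm a * K)\<^sup>2) * norm x"
proof -
  have T_add: "T (y + z) = T y + T z" if "y \<in> Z" "z \<in> Z" for y z
    using T that by (auto simp: operators_on_def bounded_linear_on_def)
  have T_smul: "T (smul d y) = smul d (T y)" if "y \<in> Z" for y d
    using T that by (auto simp: operators_on_def bounded_linear_on_def)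
  have TZ: "T y \<in> Z" if "y \<in> Z" for y
    using T that by (auto simp: operators_on_def)
  have lower: "(1 - norm a * c) * norm z \<le> norm (z - smul a (T z))" if z: "z \<in> Z" for z
  proof (cases "z = 0")
    case False
    obtain f where f: "(z /\<^sub>R norm z, f) \<in> supporting_pairs smul Z" "f \<in> dual_on smul Z"
      "f z = of_real (norm z)" "\<And>y. norm (f y) \<le> norm y"
      using supporting_pair_exists[OF Z z False] by blast
    have "T (z /\<^sub>R norm z) = T z /\<^sub>R norm z"
      using T z by (intro bounded_linear_on_scaleR) (auto simp: operators_on_def)
    then have "f (T (z /\<^sub>R norm z)) = of_real (inverse (norm z)) * f (T z)"
      by (simp only: dual_on_scaleR[OF f(2) TZ[OF z]])
    then have "norm (f (T z)) / norm z \<le> c"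
      using c[OF f(1)] by (simp add: norm_mult norm_inverse divide_inverse mult.commute)
    then have fT: "norm (f (T z)) \<le> c * norm z"
      using False by (simp add: field_simps)
    have "f (z + smul (- a) (T z)) = f z + f (smul (- a) (T z))"
      using f(2) z subspace_scale[OF Z TZ[OF z], of "- a"]
      unfolding dual_on_def bounded_linear_on_def by blast
    also have "f (smul (- a) (T z)) = - a * f (T z)"
      using f(2) TZ[OF z] unfolding dual_on_def bounded_linear_on_def by blast
    finally have "f (z + smul (- a) (T z)) = of_real (norm z) - a * f (T z)"
      by (simp add: f(3))
    then have "norm (of_real (norm z) - a * f (T z)) \<le> norm (z - smul a (T z))"
      using f(4)[of "z + smul (- a) (T z)"] by (simp add: scale_minus_left)
    moreover have "norm z - norm a * norm (f (T z)) \<le> norm (of_real (norm z) - a * f (T z))"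
      using norm_triangle_ineq2[of "of_real (norm z)" "a * f (T z)"] by (simp add: norm_mult)
    moreover have "norm a * norm (f (T z)) \<le> norm a * (c * norm z)"
      by (intro mult_left_mono fT) simp
    ultimately show ?thesis by (simp add: algebra_simps)
  qed simp
  let ?z = "x + smul a (T x)"
  have aT: "smul a (T x) \<in> Z" by (intro subspace_scale[OF Z] TZ x)
  have "(1 - norm a * c) * norm ?z \<le> norm (?z - smul a (T ?z))"
    by (intro lower subspace_add[OF Z] x aT)
  \<comment> \<open>The terms of first order in \<open>a\<close> cancel; the remaining error is
    quadratic.\<close>
  also have "?z - smul a (T ?z) = x - smul (a * a) (T (T x))"
    by (simp add: T_add[OF x aT] T_smul[OF TZ[OF x]] scale_right_distrib)
  also have "norm \<dots> \<le> norm x + norm a * norm a * norm (T (T x))"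
    using norm_triangle_ineq4[of x "smul (a * a) (T (T x))"] by (simp add: norm_smul norm_mult)
  finally have "(1 - norm a * c) * norm ?z \<le> norm x + norm a * norm a * norm (T (T x))" .
  moreover have "norm (T (T x)) \<le> K * (K * norm x)"
    using K[OF TZ[OF x]] mult_left_mono[OF K[OF x] \<open>0 \<le> K\<close>] by simp
  then have "norm a * norm a * norm (T (T x)) \<le> norm a * norm a * (K * (K * norm x))"
    by (intro mult_left_mono) auto
  ultimately show ?thesis
    by (simp add: power2_eq_square algebra_simps)
qed

text \<open>A supporting point of the whole space need not lie in any \<open>Y i\<close>, so the
  bound on pairs is first traded for the estimate of \<open>norm_add_smul_le\<close>, which passes
  to the closure. A pair violating the bound would contradict that estimate to first order in a
  small scalar.\<close>

lemma numerical_radius_le_of_dense: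
  assumes S: "S \<in> operators_on smul UNIV"
    and dense: "closure (\<Union>i\<in>I. Y i) = UNIV"
    and Y: "\<And>i. i \<in> I \<Longrightarrow> subspace (Y i)" "\<And>i. i \<in> I \<Longrightarrow> S ` Y i \<subseteq> Y i"
    and c: "\<And>i x f. i \<in> I \<Longrightarrow> (x, f) \<in> supporting_pairs smul (Y i) \<Longrightarrow> norm (f (S x)) \<le> c"
    and p: "(x, f) \<in> supporting_pairs smul UNIV"
  shows "norm (f (S x)) \<le> c"
proof (rule ccontr)
  define v where "v = norm (f (S x))"
  assume "\<not> norm (f (S x)) \<le> c"
  then have vc: "c < v" by (simp add: v_def)
  have bS: "bounded_linear_on smul smul UNIV S"
    using S by (simp add: operators_on_def)
  define K where "K = \<bar>onorm_on UNIV S\<bar>"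
  have K: "norm (S y) \<le> K * norm y" for y
  proof -
    have "norm (S y) \<le> onorm_on UNIV S * norm y" by (rule norm_le_onorm_on[OF bS]) simp
    also have "\<dots> \<le> K * norm y" by (intro mult_right_mono) (auto simp: K_def)
    finally show ?thesis .
  qed
  have lin_S: "bounded_linear S"
    using bS K bounded_linear_on_scaleR[OF bS]
    by (intro bounded_linear_intro[where K = K]) (auto simp: bounded_linear_on_def mult.commute)
  have bound: "(1 - norm a * c) * norm (y + smul a (S y)) \<le> (1 + (norm a * K)\<^sup>2) * norm y"
    for a y
  proof -
    let ?A = "{y. (1 - norm a * c) * norm (y + smul a (S y)) \<le> (1 + (norm a * K)\<^sup>2) * norm y}"
    \<comment> \<open>Both sides are continuous in \<open>y\<close>, so the estimate extends from
      the dense union.\<close>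
    have "closed ?A"
      by (intro closed_Collect_le continuous_intros bounded_linear.continuous_on[OF bounded_linear_smul]
          bounded_linear.continuous_on[OF lin_S])
    moreover have "(\<Union>i\<in>I. Y i) \<subseteq> ?A"
    proof (intro UN_least subsetI CollectI)
      fix i z assume i: "i \<in> I" and z: "z \<in> Y i"
      have "S \<in> operators_on smul (Y i)"
        using bounded_linear_on_subset[OF bS subset_UNIV] Y(2)[OF i] by (simp add: operators_on_def)
      then show "(1 - norm a * c) * norm (z + smul a (S z)) \<le> (1 + (norm a * K)\<^sup>2) * norm z"
        using K c[OF i] z by (intro norm_add_smul_le[OF Y(1)[OF i]]) (auto simp: K_def)
    qed
    ultimately have "closure (\<Union>i\<in>I. Y i) \<subseteq> ?A" by (intro closure_minimal)
    then show ?thesis using dense by blast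
  qed
  have fx: "norm x = 1" "f x = 1" and f: "f \<in> dual_on smul UNIV" "\<And>y. norm (f y) \<le> norm y"
    using p by (auto simp: supporting_pairs_def)
  obtain \<theta> where \<theta>: "norm \<theta> = 1" "\<theta> * f (S x) = of_real v"
    using unit_scalar_exists unfolding v_def by blast
  \<comment> \<open>Below, \<open>f\<close> tested at \<open>x + t \<theta> S x\<close> gives
    \<open>(1 - t c) (1 + t v) \<le> 1 + (t K)^2\<close>, that is
    \<open>v - c \<le> t (K^2 + c v)\<close>. \<open>M\<close> dominates both \<open>c\<close> and
    \<open>K^2 + c v\<close>. The first term in the minimum keeps \<open>1 - t c\<close>
    nonnegative, the second makes the right side at most \<open>(v - c) / 2\<close>.\<close>
  define M where "M = K\<^sup>2 + \<bar>c * v\<bar> + \<bar>c\<bar> + 1"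
  have "M > 0" by (simp add: M_def add_nonneg_pos)
  define t where "t = min (1 / M) ((v - c) / (2 * M))"
  have "t > 0" using vc \<open>M > 0\<close> by (simp add: t_def)
  have tM: "t * M \<le> 1" "t * M \<le> (v - c) / 2"
    using \<open>M > 0\<close> mult_right_mono[of t "1 / M" M] mult_right_mono[of t "(v - c) / (2 * M)" M]
    by (simp_all add: t_def)
  have "c \<le> M" unfolding M_def using zero_le_power2[of K] by linarith
  then have "t * c \<le> t * M" using \<open>t > 0\<close> by simp
  then have tc: "t * c \<le> 1" using tM by simp
  have a: "norm (of_real t * \<theta>) = t" using \<open>t > 0\<close> \<theta> by (simp add: norm_mult)
  have "f (x + smul (of_real t * \<theta>) (S x)) = 1 + of_real t * (\<theta> * f (S x))"
    using f(1) fx by (simp add: dual_on_def bounded_linear_on_def mult.assoc)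
  also have "\<dots> = of_real (1 + t * v)" by (simp add: \<theta>)
  finally have "norm (of_real (1 + t * v) :: 'k) \<le> norm (x + smul (of_real t * \<theta>) (S x))"
    using f(2) by metis
  then have "1 + t * v \<le> norm (x + smul (of_real t * \<theta>) (S x))"
    unfolding norm_of_real by linarith
  then have "(1 - t * c) * (1 + t * v) \<le> (1 - t * c) * norm (x + smul (of_real t * \<theta>) (S x))"
    using tc by (intro mult_left_mono) auto
  also have "\<dots> \<le> 1 + (t * K)\<^sup>2"
    using bound[of "of_real t * \<theta>" x] by (simp only: a fx mult_1_right)
  finally have "t * (v - c) \<le> t * (t * (K\<^sup>2 + c * v))"
    by (simp add: algebra_simps power2_eq_square)
  then have "v - c \<le> t * (K\<^sup>2 + c * v)" using \<open>t > 0\<close> by simp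
  also have "\<dots> \<le> t * M"
    using \<open>t > 0\<close> by (intro mult_left_mono) (auto simp: M_def)
  also have "\<dots> \<le> (v - c) / 2" by (rule tM)
  finally show False using vc by simp
qed

end

section \<open>Chains of contractive projections\<close>

text \<open>The composition of \<open>P m\<close>, ..., \<open>P (m + j - 1)\<close> from
  \<open>X (m + j)\<close> to \<open>X m\<close>; the projection of highest index acts
  first.\<close>

primrec iterated_projection :: "(nat \<Rightarrow> 'a \<Rightarrow> 'a) \<Rightarrow> nat \<Rightarrow> nat \<Rightarrow> 'a \<Rightarrow> 'a" where
  "iterated_projection P m 0 x = x"
| "iterated_projection P m (Suc j) x = iterated_projection P m j (P (m + j) x)"

locale projection_chain = banach_space smul
  for smul :: "'k::real_or_complex \<Rightarrow> 'a::banach \<Rightarrow> 'a" +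
  fixes X :: "nat \<Rightarrow> 'a set" and P :: "nat \<Rightarrow> 'a \<Rightarrow> 'a"
  assumes subspace_X: "m \<ge> 1 \<Longrightarrow> subspace (X m)"
    and closed_X: "m \<ge> 1 \<Longrightarrow> closed (X m)"
    and X_Suc: "m \<ge> 1 \<Longrightarrow> X m \<subseteq> X (m + 1)"
    and dense_X: "closure (\<Union>m\<in>{1..}. X m) = UNIV"
    and projection_P: "m \<ge> 1 \<Longrightarrow> projection_onto smul (X (m + 1)) (X m) (P m)"
    and onorm_P: "m \<ge> 1 \<Longrightarrow> onorm_on (X (m + 1)) (P m) = 1"
begin

lemma X_mono:
  assumes "1 \<le> m" "m \<le> n" shows "X m \<subseteq> X n"
  using assms(2)
proof (induction rule: dec_induct)
  case (step n)
  then show ?case using X_Suc[of n] assms(1) by simp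
qed simp

lemma P_operator: "m \<ge> 1 \<Longrightarrow> P m \<in> operators_on smul (X (m + 1))"
  using projection_P by (auto simp: projection_onto_def)

lemma P_in: "m \<ge> 1 \<Longrightarrow> x \<in> X (m + 1) \<Longrightarrow> P m x \<in> X m"
  using projection_P by (auto simp: projection_onto_def)

lemma P_id:
  assumes "m \<ge> 1" "x \<in> X m" shows "P m x = x"
proof -
  obtain y where "y \<in> X (m + 1)" "x = P m y"
    using projection_P[OF assms(1)] assms(2) by (auto simp: projection_onto_def)
  then show ?thesis
    using projection_P[OF assms(1)] by (auto simp: projection_onto_def)
qed

lemma norm_P_le: "m \<ge> 1 \<Longrightarrow> x \<in> X (m + 1) \<Longrightarrow> norm (P m x) \<le> norm x"
  using norm_le_onorm_on[of smul smul "X (m + 1)" "P m" x] P_operator[of m] onorm_P[of m]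
  by (auto simp: operators_on_def)

text \<open>A projection onto the zero space would have norm 0. Nontriviality is what gives the
  real-valued suprema and infima their meaning on each \<open>X m\<close>.\<close>

lemma X_nontrivial:
  assumes m: "m \<ge> 1" shows "X m \<noteq> {0}"
proof
  assume "X m = {0}"
  then have "onorm_on (X (m + 1)) (P m) \<le> 0"
    using P_in[OF m] subspace_0[OF subspace_X, of "m + 1"] by (intro onorm_on_le) auto
  then show False using onorm_P[OF m] by simp
qed

lemma dense_X_from:
  assumes m: "m \<ge> 1" shows "closure (\<Union>k\<in>{m..}. X k) = UNIV"
proof -
  have "(\<Union>k\<in>{1..}. X k) \<subseteq> (\<Union>k\<in>{m..}. X k)"
  proof (intro UN_least)
    fix k :: nat assume "k \<in> {1..}"
    then have "X k \<subseteq> X (max m k)" by (intro X_mono) auto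
    then show "X k \<subseteq> (\<Union>k\<in>{m..}. X k)" by fastforce
  qed
  from closure_mono[OF this] show ?thesis using dense_X by auto
qed

text \<open>Each extra projection starts from a higher level and fixes what already lies below.
  Hence, in the last part, the value at \<open>x\<close> does not depend on the level from which the
  descent starts, and the maps glue on the union.\<close>

lemma iterated_projection_props:
  assumes m: "m \<ge> 1"
  shows "x \<in> X (m + j) \<Longrightarrow> iterated_projection P m j x \<in> X m"
    and "x \<in> X (m + j) \<Longrightarrow> norm (iterated_projection P m j x) \<le> norm x"
    and "x \<in> X (m + j) \<Longrightarrow> y \<in> X (m + j) \<Longrightarrow>
      iterated_projection P m j (x + y) = iterated_projection P m j x + iterated_projection P m j y"
    and "x \<in> X (m + j) \<Longrightarrow>
      iterated_projection P m j (smul c x) = smul c (iterated_projection P m j x)"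
    and "x \<in> X (m + j) \<Longrightarrow> iterated_projection P m (j + i) x = iterated_projection P m j x"
proof (induction j arbitrary: x y)
  case 0
  {
    case 5
    then have "x \<in> X (m + i)" for i using X_mono[OF m, of "m + i"] by auto
    then show ?case
      using 5 m by (induction i) (auto simp: P_id)
  }
next
  case (Suc j)
  have m': "m + j \<ge> 1" using m by simp
  have in_X: "P (m + j) x \<in> X (m + j)" if "x \<in> X (m + Suc j)" for x
    using P_in[OF m'] that by simp
  {
    case 1
    then show ?case using Suc.IH(1)[OF in_X] by simp
  next
    case 2
    then show ?case
      using order_trans[OF Suc.IH(2)[OF in_X] norm_P_le[OF m']] by simp
  next
    case 3
    then show ?case
      using Suc.IH(3)[OF in_X in_X] P_operator[OF m']
      by (simp add: operators_on_def bounded_linear_on_def)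
  next
    case 4
    then show ?case
      using Suc.IH(4)[OF in_X] P_operator[OF m']
      by (simp add: operators_on_def bounded_linear_on_def)
  next
    case 5
    have "iterated_projection P m (Suc j + i) x = iterated_projection P m (Suc j) x"
      if "x \<in> X (m + Suc j)" for i
    proof (induction i)
      case (Suc i)
      have "x \<in> X (m + (Suc j + i))"
        using X_mono[of "m + Suc j" "m + (Suc j + i)"] m that by auto
      then have "P (m + (Suc j + i)) x = x" by (intro P_id) simp
      then show ?case using Suc by simp
    qed simp
    then show ?case using 5 by blast
  }
qed simp_all

text \<open>On the union the glued map is linear and 1-Lipschitz, so it extends to the closure.
  Linearity passes to limits, and the values stay in \<open>X m\<close> because it is closed. The
  last property is what lets LCC be applied one level at a time.\<close>

lemma contractive_projection_exists:
  assumes m: "m \<ge> 1"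
  obtains Q where "Q \<in> operators_on smul UNIV" "\<And>x. Q x \<in> X m" "\<And>x. norm (Q x) \<le> norm x"
    "\<And>x. x \<in> X m \<Longrightarrow> Q x = x"
    "\<And>k x. m \<le> k \<Longrightarrow> x \<in> X (k + 1) \<Longrightarrow> Q (P k x) = Q x"
proof -
  let ?R = "iterated_projection P m"
  note R = iterated_projection_props[OF m]
  define D where "D = (\<Union>j. X (m + j))"
  have "(\<Union>k\<in>{m..}. X k) \<subseteq> D"
    unfolding D_def by (auto simp: le_iff_add)
  then have D: "closure D = UNIV"
    using closure_mono dense_X_from[OF m] by blast
  \<comment> \<open>The least level is one admissible choice; the next fact allows any level
    containing \<open>x\<close>.\<close>
  define q where "q x = ?R (LEAST j. x \<in> X (m + j)) x" for x
  have q: "q x = ?R j x" if x: "x \<in> X (m + j)" for x j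
  proof -
    let ?l = "LEAST j. x \<in> X (m + j)"
    have "x \<in> X (m + ?l)" using x by (rule LeastI)
    moreover have "?l \<le> j" using x by (rule Least_le)
    ultimately show ?thesis using R(5)[of x ?l "j - ?l"] by (simp add: q_def)
  qed
  have common: "\<exists>j. x \<in> X (m + j) \<and> y \<in> X (m + j)" if xy: "x \<in> D" "y \<in> D" for x y
  proof -
    obtain i j where "x \<in> X (m + i)" "y \<in> X (m + j)" using xy by (auto simp: D_def)
    then have "x \<in> X (m + max i j)" "y \<in> X (m + max i j)"
      using X_mono[of "m + i" "m + max i j"] X_mono[of "m + j" "m + max i j"] m by auto
    then show ?thesis by blast
  qed
  have D_add: "x + y \<in> D" and q_add: "q (x + y) = q x + q y" if xy: "x \<in> D" "y \<in> D" for x y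
  proof -
    obtain j where j: "x \<in> X (m + j)" "y \<in> X (m + j)" using common[OF xy] by blast
    then have "x + y \<in> X (m + j)" using m by (intro subspace_add[OF subspace_X]) auto
    with j show "x + y \<in> D" "q (x + y) = q x + q y"
      by (auto simp: D_def q R(3))
  qed
  have D_smul: "smul c x \<in> D" and q_smul: "q (smul c x) = smul c (q x)" if x: "x \<in> D" for c x
  proof -
    obtain j where j: "x \<in> X (m + j)" using x by (auto simp: D_def)
    then have "smul c x \<in> X (m + j)" using m by (intro subspace_scale[OF subspace_X]) auto
    with j show "smul c x \<in> D" "q (smul c x) = smul c (q x)"
      by (auto simp: D_def q R(4))
  qed
  have q_norm: "norm (q x) \<le> norm x" and q_in: "q x \<in> X m" if "x \<in> D" for x
    using that by (auto simp: D_def q R(1,2))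
  have "1-lipschitz_on D q"
  proof (rule lipschitz_onI)
    fix x y assume xy: "x \<in> D" "y \<in> D"
    have d: "x + smul (-1) y \<in> D" by (intro D_add D_smul xy)
    have "q x - q y = q (x + smul (-1) y)"
      by (simp only: q_add[OF xy(1) D_smul[OF xy(2)]] q_smul[OF xy(2)]) simp
    then show "dist (q x) (q y) \<le> 1 * dist x y"
      using q_norm[OF d] by (simp add: dist_norm)
  qed simp
  then obtain Q where Q: "1-lipschitz_on UNIV Q" "\<And>x. x \<in> D \<Longrightarrow> Q x = q x"
    using lipschitz_extend_closure D by metis
  have cont: "(\<lambda>n. Q (s n)) \<longlonglongrightarrow> Q l" if "s \<longlonglongrightarrow> l" for s l
    using continuous_on_tendsto_compose[OF lipschitz_on_continuous_on[OF Q(1)] that] by simp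
  have approx: "\<exists>s. (\<forall>n. s n \<in> D) \<and> s \<longlonglongrightarrow> x" for x
    using closure_sequential[of x D] D by simp
  have Q_in: "Q x \<in> X m" for x
  proof -
    obtain s where s: "\<forall>n. s n \<in> D" "s \<longlonglongrightarrow> x" using approx by blast
    then have "Q (s n) \<in> X m" for n by (simp add: Q(2) q_in)
    then show ?thesis using closed_sequentially[OF closed_X[OF m] _ cont[OF s(2)]] by blast
  qed
  have Q_add: "Q (x + y) = Q x + Q y" for x y
  proof -
    obtain s t where s: "\<forall>n. s n \<in> D" "s \<longlonglongrightarrow> x" and t: "\<forall>n. t n \<in> D" "t \<longlonglongrightarrow> y"
      using approx by metis
    have "(\<lambda>n. Q (s n + t n)) \<longlonglongrightarrow> Q (x + y)" by (intro cont tendsto_add s t)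
    moreover have "Q (s n + t n) = Q (s n) + Q (t n)" for n
      using s t by (simp add: Q(2) D_add q_add)
    ultimately have "(\<lambda>n. Q (s n) + Q (t n)) \<longlonglongrightarrow> Q (x + y)" by simp
    moreover have "(\<lambda>n. Q (s n) + Q (t n)) \<longlonglongrightarrow> Q x + Q y" by (intro tendsto_add cont s t)
    ultimately show ?thesis by (rule LIMSEQ_unique)
  qed
  have Q_smul: "Q (smul c x) = smul c (Q x)" for c x
  proof -
    obtain s where s: "\<forall>n. s n \<in> D" "s \<longlonglongrightarrow> x" using approx by blast
    have "(\<lambda>n. Q (smul c (s n))) \<longlonglongrightarrow> Q (smul c x)"
      by (intro cont bounded_linear.tendsto[OF bounded_linear_smul] s)
    moreover have "Q (smul c (s n)) = smul c (Q (s n))" for n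
      using s by (simp add: Q(2) D_smul q_smul)
    ultimately have "(\<lambda>n. smul c (Q (s n))) \<longlonglongrightarrow> Q (smul c x)" by simp
    moreover have "(\<lambda>n. smul c (Q (s n))) \<longlonglongrightarrow> smul c (Q x)"
      by (intro bounded_linear.tendsto[OF bounded_linear_smul] cont s)
    ultimately show ?thesis by (rule LIMSEQ_unique)
  qed
  have "Q 0 = 0" using Q_add[of 0 0] by simp
  then have Q_norm: "norm (Q x) \<le> norm x" for x
    using lipschitz_onD[OF Q(1), of x 0] by simp
  show thesis
  proof (rule that[of Q])
    show "Q \<in> operators_on smul UNIV"
      using Q_norm by (auto simp: operators_on_def bounded_linear_on_def Q_add Q_smul
          intro!: exI[of _ 1])
    have Q_R: "Q x = ?R j x" if "x \<in> X (m + j)" for x j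
      using that Q(2)[of x] q by (auto simp: D_def)
    show "Q x = x" if "x \<in> X m" for x
      using Q_R[of x 0] that by simp
    show "Q (P k x) = Q x" if k: "m \<le> k" and x: "x \<in> X (k + 1)" for k x
    proof -
      obtain j where j: "k = m + j" using k le_Suc_ex by blast
      have "P k x \<in> X (m + j)" using P_in[of k x] m k x j by simp
      \<comment> \<open>The iterate of length \<open>Suc j\<close> begins with \<open>P k\<close>,
        so both sides are the same iterate.\<close>
      then show ?thesis using Q_R[of "P k x" j] Q_R[of x "Suc j"] x by (simp add: j)
    qed
  qed (rule Q_in Q_norm)+
qed

section \<open>Lower bound: extending operators from \<open>X m\<close> to the whole space\<close>

lemma numerical_index_UNIV_le:
  assumes lcc: "local_characterization_condition smul X P" and m: "m \<ge> 1"
  shows "numerical_index smul UNIV \<le> numerical_index smul (X m)"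
proof (rule numerical_index_greatest[OF subspace_X[OF m] X_nontrivial[OF m]])
  fix T assume T: "T \<in> operators_on smul (X m)" "onorm_on (X m) T = 1"
  have bT: "bounded_linear_on smul smul (X m) T" and TX: "T ` X m \<subseteq> X m"
    using T(1) by (auto simp: operators_on_def)
  define \<nu> where "\<nu> = numerical_radius smul (X m) T"
  have "\<nu> \<ge> 0"
    unfolding \<nu>_def by (intro numerical_radius_nonneg subspace_X X_nontrivial m T)
  obtain Q where Q: "Q \<in> operators_on smul UNIV" "\<And>x. Q x \<in> X m" "\<And>x. norm (Q x) \<le> norm x"
    "\<And>x. x \<in> X m \<Longrightarrow> Q x = x" "\<And>k x. m \<le> k \<Longrightarrow> x \<in> X (k + 1) \<Longrightarrow> Q (P k x) = Q x"
    using contractive_projection_exists[OF m] by blast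
  define S where "S x = T (Q x)" for x
  have S_in: "S x \<in> X m" for x using TX Q(2) by (auto simp: S_def)
  have bS: "bounded_linear_on smul smul UNIV S"
    unfolding S_def using Q(1,2)
    by (intro bounded_linear_on_compose[OF _ bT]) (auto simp: operators_on_def)
  then have S: "S \<in> operators_on smul UNIV" by (simp add: operators_on_def)
  have T_norm: "norm (T x) \<le> norm x" if "x \<in> X m" for x
    using norm_le_onorm_on[OF bT that] T(2) by simp
  have "onorm_on UNIV S = 1"
  proof (rule antisym)
    show "onorm_on UNIV S \<le> 1"
      using order_trans[OF T_norm[OF Q(2)] Q(3)] by (intro onorm_on_le) (auto simp: S_def)
    obtain y where "y \<in> X m" "y \<noteq> 0"
      using X_nontrivial[OF m] subspace_0[OF subspace_X[OF m]] by blast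
    then have S0: "0 \<le> onorm_on UNIV S" by (intro onorm_on_nonneg[OF bS UNIV_I])
    \<comment> \<open>\<open>Q\<close> fixes \<open>X m\<close>, so \<open>S\<close> extends
      \<open>T\<close> and cannot have smaller norm.\<close>
    have "norm (T x) \<le> onorm_on UNIV S * norm x" if "x \<in> X m" for x
      using norm_le_onorm_on[OF bS UNIV_I, of x] by (simp add: S_def Q(4)[OF that])
    then have "onorm_on (X m) T \<le> onorm_on UNIV S"
      using subspace_0[OF subspace_X[OF m]] S0 by (intro onorm_on_le) auto
    then show "1 \<le> onorm_on UNIV S" by (simp add: T(2))
  qed
  have pairs: "norm (f (S x)) \<le> \<nu>" if "m \<le> k" "(x, f) \<in> supporting_pairs smul (X k)" for k x f
    using that
  proof (induction k arbitrary: x f rule: dec_induct)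
    case base
    then have "S x = T x" by (simp add: S_def Q(4) supporting_pairs_def)
    then show ?case using numerical_radius_upper[OF T(1) base] by (simp add: \<nu>_def)
  next
    case (step k)
    have k: "k \<ge> 1" using m step by simp
    have x: "x \<in> X (k + 1)" "norm x = 1" and f: "f \<in> dual_on smul (X (k + 1))"
      "\<And>y. y \<in> X (k + 1) \<Longrightarrow> norm (f y) \<le> norm y" "f x = 1" "onorm_on (X (k + 1)) f = 1"
      using step.prems supporting_pairs_iff_onorm_on[of x f smul] by (auto simp: supporting_pairs_def)
    \<comment> \<open>Moving the point down one level leaves the value of \<open>S\<close>
      unchanged.\<close>
    have SP: "S (P k x) = S x" using Q(5)[OF step(1) x(1)] by (simp add: S_def)
    show ?case
    proof (cases "P k x = 0")
      \<comment> \<open>LCC says nothing here, but \<open>S x = S (P k x) = 0\<close>.\<close>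
      case True
      have "S x = S (0 *\<^sub>R 0)" using SP True by simp
      also have "\<dots> = 0 *\<^sub>R S 0" by (rule bounded_linear_on_scaleR[OF bS]) simp
      finally have "S x = 0" by simp
      moreover have "f (0 *\<^sub>R x) = of_real 0 * f x" by (rule dual_on_scaleR[OF f(1) x(1)])
      ultimately show ?thesis using \<open>\<nu> \<ge> 0\<close> by simp
    next
      case False
      have "norming_functional smul (X (k + 1)) f x"
        using f x by (simp add: norming_functional_def)
      then obtain b :: real where b: "norming_functional smul (X k) (\<lambda>z. of_real b * f z) (P k x)"
        using lcc k x False unfolding local_characterization_condition_def by blast
      define g where "g z = of_real b * f z" for z
      have g: "g \<in> dual_on smul (X k)" "onorm_on (X k) g = 1" "g (P k x) = of_real (norm (P k x))"
        using b unfolding norming_functional_def g_def by auto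
      have Px: "P k x \<in> X k" by (rule P_in[OF k x(1)])
      define y where "y = P k x /\<^sub>R norm (P k x)"
      have "g y = 1"
        using False unfolding y_def by (simp add: dual_on_scaleR[OF g(1) Px] g(3) flip: of_real_mult)
      then have "(y, g) \<in> supporting_pairs smul (X k)"
        using False g Px subspace_scaleR[OF subspace_X[OF k]]
        by (simp add: supporting_pairs_iff_onorm_on y_def)
      then have "norm (g (S y)) \<le> \<nu>" by (rule step.IH)
      moreover have "S y = S x /\<^sub>R norm (P k x)"
        unfolding y_def SP[symmetric] by (rule bounded_linear_on_scaleR[OF bS]) simp
      moreover have "S x \<in> X (k + 1)"
        using S_in X_mono[OF m, of "k + 1"] step(1) by auto
      ultimately have "norm (of_real b * (of_real (inverse (norm (P k x))) * f (S x))) \<le> \<nu>"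
        unfolding g_def by (simp only: dual_on_scaleR[OF f(1)])
      then have "\<bar>b\<bar> * norm (f (S x)) / norm (P k x) \<le> \<nu>"
        by (simp add: norm_mult norm_inverse norm_divide divide_inverse mult_ac)
      then have "\<bar>b\<bar> * norm (f (S x)) \<le> \<nu> * norm (P k x)"
        using False by (simp add: field_simps)
      \<comment> \<open>The constant \<open>b\<close> cancels: \<open>g\<close> is norming for
        \<open>P k x\<close>, so \<open>norm (P k x)\<close> carries the factor
        \<open>\<bar>b\<bar>\<close> as well. What remains is a bound by
        \<open>\<nu> * norm (f (P k x))\<close>, whose last factor is at most 1.\<close>
      moreover have Pb: "norm (P k x) = \<bar>b\<bar> * norm (f (P k x))"
        using arg_cong[OF g(3), of norm] by (simp add: g_def norm_mult)
      ultimately have "\<bar>b\<bar> * norm (f (S x)) \<le> \<bar>b\<bar> * (\<nu> * norm (f (P k x)))"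
        by (simp add: mult_ac)
      moreover have "\<bar>b\<bar> > 0" using Pb False by auto
      ultimately have "norm (f (S x)) \<le> \<nu> * norm (f (P k x))" by simp
      moreover have "norm (f (P k x)) \<le> norm (P k x)"
        using f(2) Px X_Suc[OF k] by blast
      then have "norm (f (P k x)) \<le> 1" using norm_P_le[OF k x(1)] x(2) by simp
      then have "\<nu> * norm (f (P k x)) \<le> \<nu> * 1" using \<open>\<nu> \<ge> 0\<close> by (rule mult_left_mono)
      ultimately show ?thesis by simp
    qed
  qed
  have "numerical_index smul UNIV \<le> numerical_radius smul UNIV S"
    by (rule numerical_index_le) (use S \<open>onorm_on UNIV S = 1\<close> in auto)
  also have "\<dots> \<le> \<nu>"
  proof (rule numerical_radius_least)
    show "UNIV \<noteq> {0::'a}" using X_nontrivial[OF m] subspace_0[OF subspace_X[OF m]] by auto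
    fix x f assume p: "(x, f) \<in> supporting_pairs smul UNIV"
    show "norm (f (S x)) \<le> \<nu>"
    proof (rule numerical_radius_le_of_dense[OF S dense_X_from[OF m] _ _ _ p])
      fix k assume k: "k \<in> {m..}"
      then show "subspace (X k)" using m by (intro subspace_X) simp
      show "S ` X k \<subseteq> X k" using S_in X_mono[OF m, of k] k by auto
      show "norm (f (S x)) \<le> \<nu>" if "(x, f) \<in> supporting_pairs smul (X k)" for x f
        using pairs k that by simp
    qed
  qed simp
  finally show "numerical_index smul UNIV \<le> numerical_radius smul (X m) T" by (simp add: \<nu>_def)
qed

section \<open>Upper bound: compressing an almost optimal operator to \<open>X m\<close>\<close>

lemma numerical_index_le_UNIV_plus:
  assumes e: "e > 0"
  shows "\<exists>N. \<forall>m\<ge>N. numerical_index smul (X m) \<le> numerical_index smul UNIV + e"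
proof -
  have nontrivial: "UNIV \<noteq> {0::'a}"
    using X_nontrivial[of 1] subspace_0[OF subspace_X[of 1]] by auto
  \<comment> \<open>If every operator of norm 1 had radius at least \<open>n(X) + e / 2\<close>, so
    would the infimum.\<close>
  have "\<not> numerical_index smul UNIV + e / 2 \<le> numerical_index smul UNIV" using e by simp
  then obtain S where S: "S \<in> operators_on smul UNIV" "onorm_on UNIV S = 1"
    and radius: "numerical_radius smul UNIV S < numerical_index smul UNIV + e / 2"
    using numerical_index_greatest[OF subspace_UNIV nontrivial] not_le by blast
  have bS: "bounded_linear_on smul smul UNIV S" using S(1) by (simp add: operators_on_def)
  have S_norm: "norm (S x) \<le> norm x" for x
    using norm_le_onorm_on[OF bS, of x] S(2) by simp
  \<comment> \<open>The bound 1 keeps \<open>1 - \<delta>\<close> nonnegative; the bound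
    \<open>e / 2\<close> is the share of the error left beside the choice of
    \<open>S\<close>.\<close>
  define \<delta> where "\<delta> = min (e / 2) 1"
  have \<delta>: "0 < \<delta>" "\<delta> \<le> 1" "\<delta> \<le> e / 2" using e by (auto simp: \<delta>_def)
  have "bounded_linear S"
    using bS S_norm bounded_linear_on_scaleR[OF bS]
    by (intro bounded_linear_intro[where K = 1]) (auto simp: bounded_linear_on_def)
  note S_cont = bounded_linear.continuous_on[OF this continuous_on_id]
  have "\<exists>x. (1 - \<delta>) * norm x < norm (S x)"
  proof (rule ccontr)
    assume "\<not> ?thesis"
    then have "onorm_on UNIV S \<le> 1 - \<delta>" using \<delta> by (intro onorm_on_le) (auto simp: not_less)
    then show False using S(2) \<delta> by simp
  qed
  \<comment> \<open>The almost norming vectors of \<open>S\<close> form a nonempty open set, so one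
    of them lies in some \<open>X k\<close>.\<close>
  moreover have "open {x. (1 - \<delta>) * norm x < norm (S x)}"
    by (intro open_Collect_less continuous_intros S_cont)
  ultimately have "{x. (1 - \<delta>) * norm x < norm (S x)} \<inter> (\<Union>k\<in>{1..}. X k) \<noteq> {}"
    using dense_X open_Int_closure_eq_empty by blast
  then obtain x k where k: "k \<ge> 1" "x \<in> X k" and x: "(1 - \<delta>) * norm x < norm (S x)" by auto
  \<comment> \<open>Half of the excess at \<open>x\<close>: with \<open>Q z = z\<close>, the error
    \<open>S x - Q (S x)\<close> is less than twice \<open>\<eta>\<close>, so the compression keeps
    \<open>x\<close> almost norming.\<close>
  define \<eta> where "\<eta> = (norm (S x) - (1 - \<delta>) * norm x) / 2"
  have "\<eta> > 0" using x by (simp add: \<eta>_def)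
  then obtain z where "z \<in> (\<Union>k\<in>{1..}. X k)" "dist z (S x) < \<eta>"
    using dense_X closure_approachable[of "S x"] by blast
  then obtain l where l: "l \<ge> 1" "z \<in> X l" and z: "norm (z - S x) < \<eta>" by (auto simp: dist_norm)
  show ?thesis
  proof (intro exI allI impI)
    fix m assume mN: "m \<ge> max k l"
    then have m: "m \<ge> 1" using k by simp
    have xm: "x \<in> X m" and zm: "z \<in> X m"
      using X_mono[of k m] X_mono[of l m] k l mN by auto
    obtain Q where Q: "Q \<in> operators_on smul UNIV" "\<And>x. Q x \<in> X m" "\<And>x. norm (Q x) \<le> norm x"
      "\<And>x. x \<in> X m \<Longrightarrow> Q x = x"
      by (rule contractive_projection_exists[OF m]) (rule that)
    have bQ: "bounded_linear_on smul smul UNIV Q" using Q(1) by (simp add: operators_on_def)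
    define T where "T y = Q (S y)" for y
    have bT: "bounded_linear_on smul smul (X m) T"
      unfolding T_def
      by (rule bounded_linear_on_subset[OF bounded_linear_on_compose[OF bS bQ]]) auto
    then have T: "T \<in> operators_on smul (X m)" using Q(2) by (auto simp: operators_on_def T_def)
    have radius_T: "numerical_radius smul (X m) T \<le> numerical_radius smul UNIV S"
    proof (rule numerical_radius_least[OF subspace_X[OF m] X_nontrivial[OF m]])
      fix y f assume p: "(y, f) \<in> supporting_pairs smul (X m)"
      have "bounded_linear_on smul (*) UNIV (\<lambda>v. f (Q v))"
        using p Q(2) by (intro bounded_linear_on_compose[OF bQ]) (auto simp: supporting_pairs_def dual_on_def)
      moreover have "norm (f (Q v)) \<le> norm v" for v
        using p Q(2,3) by (auto simp: supporting_pairs_def intro: order_trans)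
      ultimately have "(y, \<lambda>v. f (Q v)) \<in> supporting_pairs smul UNIV"
        using p Q(4) by (auto simp: supporting_pairs_def dual_on_def)
      from numerical_radius_upper[OF S(1) this]
      show "norm (f (T y)) \<le> numerical_radius smul UNIV S" by (simp add: T_def)
    qed
    have "Q (S x) = Q (S x - z) + Q z"
      using bQ unfolding bounded_linear_on_def by (metis UNIV_I diff_add_cancel)
    then have "S x - T x = (S x - z) - Q (S x - z)" by (simp add: T_def Q(4)[OF zm])
    then have "norm (S x - T x) \<le> norm (S x - z) + norm (Q (S x - z))"
      by (simp only: norm_triangle_ineq4)
    then have "norm (S x - T x) < 2 * \<eta>"
      using Q(3)[of "S x - z"] z norm_minus_commute[of z "S x"] by linarith
    then have "(1 - \<delta>) * norm x < norm (T x)"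
      using norm_triangle_ineq2[of "S x" "T x"] by (simp add: \<eta>_def)
    also have "\<dots> \<le> onorm_on (X m) T * norm x" by (rule norm_le_onorm_on[OF bT xm])
    finally have "1 - \<delta> \<le> onorm_on (X m) T"
      by (metis less_eq_real_def mult_less_cancel_right norm_ge_zero not_less)
    define n where "n = numerical_index smul (X m)"
    have "0 \<le> n"
      unfolding n_def
      by (intro numerical_index_greatest numerical_radius_nonneg subspace_X X_nontrivial m)
    have "n \<le> 1" unfolding n_def by (intro numerical_index_le_1 subspace_X X_nontrivial m)
    have "n * (1 - \<delta>) \<le> n * onorm_on (X m) T"
      by (intro mult_left_mono \<open>0 \<le> n\<close>) fact
    also have "\<dots> \<le> numerical_radius smul (X m) T"
      unfolding n_def by (intro numerical_index_times_onorm_on_le subspace_X X_nontrivial m T)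
    \<comment> \<open>The factor \<open>1 - \<delta>\<close> becomes an additive loss
      \<open>n * \<delta>\<close>, which \<open>n \<le> 1\<close> bounds by
      \<open>\<delta>\<close>.\<close>
    finally have "n \<le> numerical_radius smul UNIV S + n * \<delta>"
      using radius_T by (simp add: algebra_simps)
    moreover have "n * \<delta> \<le> \<delta>" using \<open>n \<le> 1\<close> \<delta>(1) by simp
    ultimately show "numerical_index smul (X m) \<le> numerical_index smul UNIV + e"
      using radius \<delta>(3) unfolding n_def by linarith
  qed
qed

end

theorem theorem2p15:
  fixes smul :: "'k::real_or_complex \<Rightarrow> 'a::banach \<Rightarrow> 'a"
    and X :: "nat \<Rightarrow> 'a set"
    and P :: "nat \<Rightarrow> 'a \<Rightarrow> 'a"
  assumes "banach_space smul"
    and "\<And>m. m \<ge> 1 \<Longrightarrow> module.subspace smul (X m)"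
    and "\<And>m. m \<ge> 1 \<Longrightarrow> closed (X m)"
    and "\<And>m. m \<ge> 1 \<Longrightarrow> X m \<subseteq> X (m + 1)"
    and "closure (\<Union>m\<in>{1..}. X m) = UNIV"
    and "\<And>m. m \<ge> 1 \<Longrightarrow> projection_onto smul (X (m + 1)) (X m) (P m)"
    and "\<And>m. m \<ge> 1 \<Longrightarrow> onorm_on (X (m + 1)) (P m) = 1"
    and "local_characterization_condition smul X P"
  shows "(\<lambda>m. numerical_index smul (X m)) \<longlonglongrightarrow> numerical_index smul UNIV"
proof -
  interpret projection_chain smul X P
    using assms(1-7) by (intro projection_chain.intro projection_chain_axioms.intro)
  show ?thesis
  proof (rule LIMSEQ_I)
    fix r :: real assume "r > 0"
    then obtain N where N: "\<And>m. m \<ge> N \<Longrightarrow>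
        numerical_index smul (X m) \<le> numerical_index smul UNIV + r / 2"
      using numerical_index_le_UNIV_plus[of "r / 2"] by auto
    \<comment> \<open>Both bounds have to apply, and \<open>X 0\<close> is unconstrained, hence the
      maximum with 1.\<close>
    show "\<exists>N. \<forall>m\<ge>N. norm (numerical_index smul (X m) - numerical_index smul UNIV) < r"
    proof (intro exI[of _ "max N 1"] allI impI)
      fix m assume "m \<ge> max N 1"
      then show "norm (numerical_index smul (X m) - numerical_index smul UNIV) < r"
        using N[of m] numerical_index_UNIV_le[OF assms(8), of m] \<open>r > 0\<close> by (simp add: abs_less_iff)
    qed
  qed
qed

end
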